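(* Let an instance of the network slicing problem be given, with associated virtual network, and consider the two mixed binary formulations (NS-I) and (NS-II) built from this same instance, with the same maximum number of paths $P\ge 1$ and the same weight $\sigma$ in the objective function. Then (NS-I) and (NS-II) are equivalent, in the following sense: for every feasible point of (NS-II) there exists a feasible point of (NS-I) such that the objective value of (NS-I) at the latter equals the objective value of (NS-II) at the former; and, conversely, for every feasible point of (NS-I) there exists a feasible point of (NS-II) such that the objective value of (NS-II) at the latter equals the objective value of (NS-I) at the former.
   Context: **Instance.** A finite directed graph $\mathcal G=(\mathcal I,\mathcal L)$ (physical network; no self-loops or parallel links); each link $(i,j)\in\mathcal L$ has a capacity $C_{i,j}\ge 0$ and a delay $d_{i,j}\ge 0$. A subset $\mathcal V\subseteq\mathcal I$ of cloud nodes; each $v\in\mathcal V$ has computational capacity $\mu_v\ge 0$ and a set of $n_v$ functions that it is able to process. A finite set $\mathcal K$ of flows (services); flow $k$ has source $S(k)$ and destination $D(k)$ in $\mathcal I\setminus\mathcal V$, a service function chain $f_1^k\to f_2^k\to\cdots\to f_{\ell_k}^k$ ($\ell_k\ge 1$), data rates $\lambda_0(k),\dots,\lambda_{\ell_k}(k)\ge 0$, NFV delays $d_{v,s}(k)\ge 0$ for $v\in\mathcal V$, $s\in\mathcal F(k):=\{1,\dots,\ell_k\}$, and an end-to-end latency threshold $\Theta_k$. An integer $P\ge1$, with $\mathcal P=\{1,\dots,P\}$, and a constant $\sigma\ge 0$. Write $\mathcal F_0(k)=\mathcal F(k)\cup\{0\}$. **Virtual network** $\bar{\mathcal G}=(\bar{\mathcal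 I},\bar{\mathcal L})$. Let $\ell_{\max}=\max_k\ell_k$ and $m_v=\min\{n_v,\ell_{\max}\}$. For each $v\in\mathcal V$ introduce $m_v$ new nodes $v_1,\dots,v_{m_v}$ (virtual cloud nodes). Let $\bar{\mathcal V}$ be the set of all virtual cloud nodes, $\bar{\mathcal I}=\mathcal I\cup\bar{\mathcal V}$, and $\bar{\mathcal L}=\mathcal L\cup\{(v,v_t),(v_t,v): v\in\mathcal V,\ 1\le t\le m_v\}$. The new links have delay $0$ and infinite capacity. For $w=v_t\in\bar{\mathcal V}$ put $N(w)=v$, the unique neighbor of $w$; so the only links at $w$ are $(w,N(w))$ and $(N(w),w)$. **Variables common to both formulations.** $x_{w,s}(k)\in\{0,1\}$ ($w\in\bar{\mathcal V}$), $x^0_{v,s}(k)\in\{0,1\}$ ($v\in\mathcal V$), for $k\in\mathcal K$, $s\in\mathcal F(k)$; $y_v\in\{0,1\}$ ($v\in\mathcal V$); real $\theta(k,s)$ ($s\in\mathcal F_0(k)$), $\theta_L(k)$, $\theta_N(k)$. If $v$ cannot process $f_s^k$, then $x_{v_t,s}(k)$ is fixed to $0$ for all $t$. **Common constraints** (for all $k\in\mathcal K$, $s\in\mathcal F(k)$, $v\in\mathcal V$, $w\in\bar{\mathcal V}$ where applicable): - $\sum_{s\in\mathcal F(k)}x_{w,s}(k)\le 1$; - $\sum_{v\in\mathcal V}x^0_{v,s}(k)=1$; - $x^0_{v,s}(k)=\sum_{t=1}^{m_v}x_{v_t,s}(k)$; - $x^0_{v,s}(k)\le y_v$; - $\sum_{k}\sum_{s\in\mathcal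 F(k)}\lambda_s(k)x^0_{v,s}(k)\le\mu_v y_v$; - $\sum_{v\in\mathcal V}\mu_vy_v\ge\sum_k\sum_{s\in\mathcal F(k)}\lambda_s(k)$; - $\theta_L(k)=\sum_{s\in\mathcal F_0(k)}\theta(k,s)$; - $\theta_N(k)=\sum_{s\in\mathcal F(k)}\sum_{v\in\mathcal V}d_{v,s}(k)x^0_{v,s}(k)$; - $\theta_L(k)+\theta_N(k)\le\Theta_k$. **Common objective:** minimize $\sum_{v\in\mathcal V}y_v+\sigma\sum_{k\in\mathcal K}(\theta_L(k)+\theta_N(k))$. **Formulation (NS-I).** For $k\in\mathcal K$, $s\in\mathcal F_0(k)$ let $\mathcal Q(k,s)$ be the set of pairs $(a,b)$ with $a\in\bar{\mathcal V}$ if $s\ge1$, $a=S(k)$ if $s=0$; $b\in\bar{\mathcal V}$ if $s\le\ell_k-1$, $b=D(k)$ if $s=\ell_k$. Put $\pi(k,s,a,b)=x_{a,s}(k)\,x_{b,s+1}(k)$ with the convention $x_{S(k),0}(k)=1$, $x_{D(k),\ell_k+1}(k)=1$ (so $\pi=x_{b,1}(k)$ for $s=0$ and $\pi=x_{a,\ell_k}(k)$ for $s=\ell_k$). Besides the common variables there are, for all $k$, $s\in\mathcal F_0(k)$, $(a,b)\in\mathcal Q(k,s)$, $p\in\mathcal P$, $(i,j)\in\bar{\mathcal L}$: $r(k,s,a,b,p)\ge0$, $r_{i,j}(k,s,a,b,p)\ge0$, $z_{i,j}(k,s,a,b,p)\in\{0,1\}$. Besides the common constraints, for all such indices: - $\sum_{p\in\mathcal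 P}r(k,s,a,b,p)=\lambda_s(k)\,\pi(k,s,a,b)$; - $z_{i,j}(k,s,a,b,p)\le\pi(k,s,a,b)$; - for every $w\in\bar{\mathcal V}$: $z_{w,N(w)}(k,s,a,b,p)+z_{N(w),w}(k,s,a,b,p)$ is $\le1$ if $w\in\{a,b\}$, and $=0$ otherwise; - $r_{i,j}(k,s,a,b,p)\le\lambda_s(k)z_{i,j}(k,s,a,b,p)$; - $\sum_{k}\sum_{s\in\mathcal F_0(k)}\sum_{(a,b)\in\mathcal Q(k,s)}\sum_{p}r_{i,j}(k,s,a,b,p)\le C_{i,j}$ for all $(i,j)\in\mathcal L$; - for every $i\in\bar{\mathcal I}$: $\sum_{j:(j,i)\in\bar{\mathcal L}}r_{j,i}(k,s,a,b,p)-\sum_{j:(i,j)\in\bar{\mathcal L}}r_{i,j}(k,s,a,b,p)$ equals $-r(k,s,a,b,p)$ if $i=a$, $0$ if $i\ne a,b$, and $r(k,s,a,b,p)$ if $i=b$; - for every $i\in\bar{\mathcal I}$: $\sum_{j:(j,i)\in\bar{\mathcal L}}z_{j,i}(k,s,a,b,p)-\sum_{j:(i,j)\in\bar{\mathcal L}}z_{i,j}(k,s,a,b,p)$ equals $-\pi(k,s,a,b)$ if $i=a$, $0$ if $i\neq a,b$, and $\pi(k,s,a,b)$ if $i=b$; - $\theta(k,s)\ge\sum_{(a,b)\in\mathcal Q(k,s)}\sum_{(i,j)\in\mathcal L}d_{i,j}z_{i,j}(k,s,a,b,p)$. (If $a=b$, then $\pi(k,s,a,b)=0$ by the first common constraint;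 in the two conservation constraints both the case $i=a$ and the case $i=b$ are imposed.) **Formulation (NS-II).** Besides the common variables there are, for all $k\in\mathcal K$, $s\in\mathcal F_0(k)$, $p\in\mathcal P$, $(i,j)\in\bar{\mathcal L}$: $r(k,s,p)\ge0$, $r_{i,j}(k,s,p)\ge0$, $z_{i,j}(k,s,p)\in\{0,1\}$. Write $\Delta^r_i(k,s,p)=\sum_{j:(j,i)\in\bar{\mathcal L}}r_{j,i}(k,s,p)-\sum_{j:(i,j)\in\bar{\mathcal L}}r_{i,j}(k,s,p)$ and $\Delta^z_i(k,s,p)$ for the same expression with $z$ in place of $r$. Besides the common constraints: - for all $k$, $s\in\mathcal F_0(k)$: $\sum_{p}r(k,s,p)=\lambda_s(k)$; - for all $w\in\bar{\mathcal V}$, $k$, $s\in\mathcal F_0(k)$, $p$: $z_{w,N(w)}(k,s,p)+z_{N(w),w}(k,s,p)\le1$; - for all $k$, $s\in\mathcal F_0(k)$, $p$: $\theta(k,s)\ge\sum_{(i,j)\in\bar{\mathcal L}}d_{i,j}z_{i,j}(k,s,p)$; - for all $(i,j)\in\bar{\mathcal L}$, $k$, $s\in\mathcal F_0(k)$, $p$: $r_{i,j}(k,s,p)\le\lambda_s(k)z_{i,j}(k,s,p)$; - for all $(i,j)\in\mathcal L$: $\sum_k\sum_{s\in\mathcal F_0(k)}\sum_pr_{i,j}(k,s,p)\le C_{i,j}$; - for all $k$, $s\in\mathcal F(k)\setminus\{\ell_k\}$, $p$: for $i\in\bar{\mathcal I}\setminus\bar{\mathcal V}$, $\Delta^r_i(k,s,p)=0$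 and $\Delta^z_i(k,s,p)=0$; for $i\in\bar{\mathcal V}$, $r_{i,N(i)}(k,s,p)=r(k,s,p)x_{i,s}(k)$, $r_{N(i),i}(k,s,p)=r(k,s,p)x_{i,s+1}(k)$, $z_{i,N(i)}(k,s,p)=x_{i,s}(k)$, $z_{N(i),i}(k,s,p)=x_{i,s+1}(k)$; - for all $k$, $p$: $\Delta^r_i(k,0,p)$ equals $-r(k,0,p)$ if $i=S(k)$, $0$ if $i\in\bar{\mathcal I}\setminus(\bar{\mathcal V}\cup\{S(k)\})$, $r(k,0,p)x_{i,1}(k)$ if $i\in\bar{\mathcal V}$; and $\Delta^z_i(k,0,p)$ equals $-1$, $0$, $x_{i,1}(k)$ in these respective cases; - for all $k$, $p$: $\Delta^r_i(k,\ell_k,p)$ equals $-r(k,\ell_k,p)x_{i,\ell_k}(k)$ if $i\in\bar{\mathcal V}$, $0$ if $i\in\bar{\mathcal I}\setminus(\bar{\mathcal V}\cup\{D(k)\})$, $r(k,\ell_k,p)$ if $i=D(k)$; and $\Delta^z_i(k,\ell_k,p)$ equals $-x_{i,\ell_k}(k)$, $0$, $1$ in these respective cases. *)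

theory Defs
  imports Complex_Main
begin

text \<open>
  The chain of flow k is \<open>sfc k 1, ..., sfc k (sfc_len k)\<close>; data rates are indexed by
  \<open>{0..sfc_len k}\<close>, NFV delays by \<open>nfv_delay k v s\<close> with \<open>s \<in> {1..sfc_len k}\<close>.
  Links form a set of pairs, so there are no parallel links.
\<close>

record ('v, 'f, 'k) slicing_instance =
  nodes :: "'v set"
  links :: "('v \<times> 'v) set"
  capacity :: "'v \<Rightarrow> 'v \<Rightarrow> real"
  delay :: "'v \<Rightarrow> 'v \<Rightarrow> real"
  cloud :: "'v set"
  comp_capacity :: "'v \<Rightarrow> real"
  processable :: "'v \<Rightarrow> 'f set"
  flows :: "'k set"
  src :: "'k \<Rightarrow> 'v"
  dst :: "'k \<Rightarrow> 'v"
  sfc_len :: "'k \<Rightarrow> nat"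
  sfc :: "'k \<Rightarrow> nat \<Rightarrow> 'f"
  data_rate :: "'k \<Rightarrow> nat \<Rightarrow> real"
  nfv_delay :: "'k \<Rightarrow> 'v \<Rightarrow> nat \<Rightarrow> real"
  latency_bound :: "'k \<Rightarrow> real"

definition valid_instance :: "('v, 'f, 'k) slicing_instance \<Rightarrow> bool" where
  "valid_instance G \<longleftrightarrow>
     finite (nodes G) \<and>
     links G \<subseteq> nodes G \<times> nodes G \<and>
     irrefl (links G) \<and>
     (\<forall>(i, j) \<in> links G. capacity G i j \<ge> 0 \<and> delay G i j \<ge> 0) \<and>
     cloud G \<subseteq> nodes G \<and>
     (\<forall>v \<in> cloud G. comp_capacity G v \<ge> 0 \<and> finite (processable G v)) \<and>
     finite (flows G) \<and>
     (\<forall>k \<in> flows G.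
        src G k \<in> nodes G - cloud G \<and>
        dst G k \<in> nodes G - cloud G \<and>
        sfc_len G k \<ge> 1 \<and>
        (\<forall>s \<in> {0..sfc_len G k}. data_rate G k s \<ge> 0) \<and>
        (\<forall>v \<in> cloud G. \<forall>s \<in> {1..sfc_len G k}. nfv_delay G k v s \<ge> 0))"


subsection \<open>The virtual network\<close>

text \<open>\<open>Virt v t\<close> is the virtual cloud node \<open>v\<^sub>t\<close>.\<close>

datatype 'v vnode = Phys 'v | Virt 'v nat

text \<open>The value 0 only serves to give the maximum a value when there are no flows.\<close>

definition max_sfc_len :: "('v, 'f, 'k) slicing_instance \<Rightarrow> nat" where
  "max_sfc_len G = Max (insert 0 (sfc_len G ` flows G))"

definition num_virt :: "('v, 'f, 'k) slicing_instance \<Rightarrow> 'v \<Rightarrow> nat" where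
  "num_virt G v = min (card (processable G v)) (max_sfc_len G)"

definition vcloud :: "('v, 'f, 'k) slicing_instance \<Rightarrow> 'v vnode set" where
  "vcloud G = {Virt v t | v t. v \<in> cloud G \<and> t \<in> {1..num_virt G v}}"

definition vnodes :: "('v, 'f, 'k) slicing_instance \<Rightarrow> 'v vnode set" where
  "vnodes G = Phys ` nodes G \<union> vcloud G"

definition vlinks :: "('v, 'f, 'k) slicing_instance \<Rightarrow> ('v vnode \<times> 'v vnode) set" where
  "vlinks G = {(Phys i, Phys j) | i j. (i, j) \<in> links G}
     \<union> {(Phys v, Virt v t) | v t. v \<in> cloud G \<and> t \<in> {1..num_virt G v}}
     \<union> {(Virt v t, Phys v) | v t. v \<in> cloud G \<and> t \<in> {1..num_virt G v}}"

text \<open>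
  The links added for virtual cloud nodes have delay 0. They have infinite capacity, so that
  capacity constraints are only imposed on physical links.
\<close>

fun vdelay :: "('v, 'f, 'k) slicing_instance \<Rightarrow> 'v vnode \<Rightarrow> 'v vnode \<Rightarrow> real" where
  "vdelay G (Phys i) (Phys j) = delay G i j"
| "vdelay G _ _ = 0"

text \<open>The unique neighbour of a virtual cloud node; only used for virtual cloud nodes.\<close>

primrec (nonexhaustive) nbr :: "'v vnode \<Rightarrow> 'v vnode" where
  "nbr (Virt v t) = Phys v"

text \<open>Inflow minus outflow at node \<open>i\<close> of a function \<open>g\<close> on the virtual links.\<close>

definition net_inflow ::
  "('v, 'f, 'k) slicing_instance \<Rightarrow> ('v vnode \<Rightarrow> 'v vnode \<Rightarrow> real) \<Rightarrow> 'v vnode \<Rightarrow> real" where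
  "net_inflow G g i =
     (\<Sum>j | (j, i) \<in> vlinks G. g j i) - (\<Sum>j | (i, j) \<in> vlinks G. g i j)"


subsection \<open>Variables, constraints and objective common to both formulations\<close>

text \<open>
  All variables are real-valued; the binary ones are constrained to \<open>{0, 1}\<close>. They are total
  functions whose values outside the index sets are irrelevant: neither the constraints nor the
  objective refer to them.
\<close>

record ('v, 'k) common_point =
  xvirt :: "'v vnode \<Rightarrow> nat \<Rightarrow> 'k \<Rightarrow> real"
  xzero :: "'v \<Rightarrow> nat \<Rightarrow> 'k \<Rightarrow> real"
  yact :: "'v \<Rightarrow> real"
  theta :: "'k \<Rightarrow> nat \<Rightarrow> real"
  thetaL :: "'k \<Rightarrow> real"
  thetaN :: "'k \<Rightarrow> real"

definition common_constraints ::
  "('v, 'f, 'k) slicing_instance \<Rightarrow> ('v, 'k, 'e) common_point_scheme \<Rightarrow> bool" where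
  "common_constraints G X \<longleftrightarrow>
     (\<forall>w \<in> vcloud G. \<forall>k \<in> flows G. \<forall>s \<in> {1..sfc_len G k}. xvirt X w s k \<in> {0, 1}) \<and>
     (\<forall>v \<in> cloud G. \<forall>k \<in> flows G. \<forall>s \<in> {1..sfc_len G k}. xzero X v s k \<in> {0, 1}) \<and>
     (\<forall>v \<in> cloud G. yact X v \<in> {0, 1}) \<and>
     (\<forall>v \<in> cloud G. \<forall>k \<in> flows G. \<forall>s \<in> {1..sfc_len G k}.
        sfc G k s \<notin> processable G v \<longrightarrow> (\<forall>t \<in> {1..num_virt G v}. xvirt X (Virt v t) s k = 0)) \<and>
     (\<forall>w \<in> vcloud G. \<forall>k \<in> flows G. (\<Sum>s = 1..sfc_len G k. xvirt X w s k) \<le> 1) \<and>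
     (\<forall>k \<in> flows G. \<forall>s \<in> {1..sfc_len G k}. (\<Sum>v \<in> cloud G. xzero X v s k) = 1) \<and>
     (\<forall>v \<in> cloud G. \<forall>k \<in> flows G. \<forall>s \<in> {1..sfc_len G k}.
        xzero X v s k = (\<Sum>t = 1..num_virt G v. xvirt X (Virt v t) s k)) \<and>
     (\<forall>v \<in> cloud G. \<forall>k \<in> flows G. \<forall>s \<in> {1..sfc_len G k}. xzero X v s k \<le> yact X v) \<and>
     (\<forall>v \<in> cloud G.
        (\<Sum>k \<in> flows G. \<Sum>s = 1..sfc_len G k. data_rate G k s * xzero X v s k)
          \<le> comp_capacity G v * yact X v) \<and>
     (\<Sum>v \<in> cloud G. comp_capacity G v * yact X v)
        \<ge> (\<Sum>k \<in> flows G. \<Sum>s = 1..sfc_len G k. data_rate G k s) \<and>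
     (\<forall>k \<in> flows G. thetaL X k = (\<Sum>s = 0..sfc_len G k. theta X k s)) \<and>
     (\<forall>k \<in> flows G.
        thetaN X k = (\<Sum>s = 1..sfc_len G k. \<Sum>v \<in> cloud G. nfv_delay G k v s * xzero X v s k)) \<and>
     (\<forall>k \<in> flows G. thetaL X k + thetaN X k \<le> latency_bound G k)"

definition objective ::
  "('v, 'f, 'k) slicing_instance \<Rightarrow> real \<Rightarrow> ('v, 'k, 'e) common_point_scheme \<Rightarrow> real" where
  "objective G \<sigma> X =
     (\<Sum>v \<in> cloud G. yact X v) + \<sigma> * (\<Sum>k \<in> flows G. thetaL X k + thetaN X k)"


subsection \<open>Formulation (NS-I)\<close>

record ('v, 'k) ns1_point = "('v, 'k) common_point" +
  r1path :: "'k \<Rightarrow> nat \<Rightarrow> 'v vnode \<Rightarrow> 'v vnode \<Rightarrow> nat \<Rightarrow> real"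
  r1link :: "'k \<Rightarrow> nat \<Rightarrow> 'v vnode \<Rightarrow> 'v vnode \<Rightarrow> nat \<Rightarrow> 'v vnode \<Rightarrow> 'v vnode \<Rightarrow> real"
  z1link :: "'k \<Rightarrow> nat \<Rightarrow> 'v vnode \<Rightarrow> 'v vnode \<Rightarrow> nat \<Rightarrow> 'v vnode \<Rightarrow> 'v vnode \<Rightarrow> real"

definition pairs ::
  "('v, 'f, 'k) slicing_instance \<Rightarrow> 'k \<Rightarrow> nat \<Rightarrow> ('v vnode \<times> 'v vnode) set" where
  "pairs G k s =
     (if s = 0 then {Phys (src G k)} else vcloud G) \<times>
     (if s = sfc_len G k then {Phys (dst G k)} else vcloud G)"

text \<open>
  The variables \<open>xvirt\<close> extended by the convention that the source hosts stage 0 and the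
  destination hosts stage \<open>sfc_len G k + 1\<close>.
\<close>

definition xext ::
  "('v, 'f, 'k) slicing_instance \<Rightarrow> ('v, 'k, 'e) common_point_scheme \<Rightarrow>
     'v vnode \<Rightarrow> nat \<Rightarrow> 'k \<Rightarrow> real" where
  "xext G X w s k =
     (if s = 0 then of_bool (w = Phys (src G k))
      else if s = sfc_len G k + 1 then of_bool (w = Phys (dst G k))
      else xvirt X w s k)"

definition pair_active ::
  "('v, 'f, 'k) slicing_instance \<Rightarrow> ('v, 'k, 'e) common_point_scheme \<Rightarrow>
     'k \<Rightarrow> nat \<Rightarrow> 'v vnode \<Rightarrow> 'v vnode \<Rightarrow> real" where
  "pair_active G X k s a b = xext G X a s k * xext G X b (s + 1) k"

definition ns1_feasible ::
  "('v, 'f, 'k) slicing_instance \<Rightarrow> nat \<Rightarrow> ('v, 'k) ns1_point \<Rightarrow> bool" where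
  "ns1_feasible G P X \<longleftrightarrow>
     common_constraints G X \<and>
     (\<forall>k \<in> flows G. \<forall>s \<in> {0..sfc_len G k}. \<forall>(a, b) \<in> pairs G k s.
        (\<Sum>p = 1..P. r1path X k s a b p) = data_rate G k s * pair_active G X k s a b) \<and>
     (\<forall>k \<in> flows G. \<forall>s \<in> {0..sfc_len G k}. \<forall>(a, b) \<in> pairs G k s. \<forall>p \<in> {1..P}.
        r1path X k s a b p \<ge> 0 \<and>
        (\<forall>(i, j) \<in> vlinks G.
           r1link X k s a b p i j \<ge> 0 \<and>
           z1link X k s a b p i j \<in> {0, 1} \<and>
           z1link X k s a b p i j \<le> pair_active G X k s a b \<and>
           r1link X k s a b p i j \<le> data_rate G k s * z1link X k s a b p i j) \<and>
        (\<forall>w \<in> vcloud G.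
           (w \<in> {a, b} \<longrightarrow> z1link X k s a b p w (nbr w) + z1link X k s a b p (nbr w) w \<le> 1) \<and>
           (w \<notin> {a, b} \<longrightarrow> z1link X k s a b p w (nbr w) + z1link X k s a b p (nbr w) w = 0)) \<and>
        (\<forall>i \<in> vnodes G.
           (i = a \<longrightarrow> net_inflow G (r1link X k s a b p) i = - r1path X k s a b p) \<and>
           (i \<noteq> a \<and> i \<noteq> b \<longrightarrow> net_inflow G (r1link X k s a b p) i = 0) \<and>
           (i = b \<longrightarrow> net_inflow G (r1link X k s a b p) i = r1path X k s a b p) \<and>
           (i = a \<longrightarrow> net_inflow G (z1link X k s a b p) i = - pair_active G X k s a b) \<and>
           (i \<noteq> a \<and> i \<noteq> b \<longrightarrow> net_inflow G (z1link X k s a b p) i = 0) \<and>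
           (i = b \<longrightarrow> net_inflow G (z1link X k s a b p) i = pair_active G X k s a b))) \<and>
     (\<forall>(i, j) \<in> links G.
        (\<Sum>k \<in> flows G. \<Sum>s = 0..sfc_len G k. \<Sum>(a, b) \<in> pairs G k s. \<Sum>p = 1..P.
           r1link X k s a b p (Phys i) (Phys j)) \<le> capacity G i j) \<and>
     (\<forall>k \<in> flows G. \<forall>s \<in> {0..sfc_len G k}. \<forall>p \<in> {1..P}.
        theta X k s \<ge> (\<Sum>(a, b) \<in> pairs G k s. \<Sum>(i, j) \<in> links G.
           delay G i j * z1link X k s a b p (Phys i) (Phys j)))"


subsection \<open>Formulation (NS-II)\<close>

record ('v, 'k) ns2_point = "('v, 'k) common_point" +
  r2path :: "'k \<Rightarrow> nat \<Rightarrow> nat \<Rightarrow> real"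
  r2link :: "'k \<Rightarrow> nat \<Rightarrow> nat \<Rightarrow> 'v vnode \<Rightarrow> 'v vnode \<Rightarrow> real"
  z2link :: "'k \<Rightarrow> nat \<Rightarrow> nat \<Rightarrow> 'v vnode \<Rightarrow> 'v vnode \<Rightarrow> real"

definition ns2_feasible ::
  "('v, 'f, 'k) slicing_instance \<Rightarrow> nat \<Rightarrow> ('v, 'k) ns2_point \<Rightarrow> bool" where
  "ns2_feasible G P X \<longleftrightarrow>
     common_constraints G X \<and>
     (\<forall>k \<in> flows G. \<forall>s \<in> {0..sfc_len G k}. (\<Sum>p = 1..P. r2path X k s p) = data_rate G k s) \<and>
     (\<forall>k \<in> flows G. \<forall>s \<in> {0..sfc_len G k}. \<forall>p \<in> {1..P}.
        r2path X k s p \<ge> 0 \<and>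
        (\<forall>(i, j) \<in> vlinks G.
           r2link X k s p i j \<ge> 0 \<and>
           z2link X k s p i j \<in> {0, 1} \<and>
           r2link X k s p i j \<le> data_rate G k s * z2link X k s p i j) \<and>
        (\<forall>w \<in> vcloud G. z2link X k s p w (nbr w) + z2link X k s p (nbr w) w \<le> 1) \<and>
        theta X k s \<ge> (\<Sum>(i, j) \<in> vlinks G. vdelay G i j * z2link X k s p i j)) \<and>
     (\<forall>(i, j) \<in> links G.
        (\<Sum>k \<in> flows G. \<Sum>s = 0..sfc_len G k. \<Sum>p = 1..P. r2link X k s p (Phys i) (Phys j))
          \<le> capacity G i j) \<and>
     (\<forall>k \<in> flows G. \<forall>s \<in> {1..sfc_len G k} - {sfc_len G k}. \<forall>p \<in> {1..P}.
        (\<forall>i \<in> vnodes G - vcloud G.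
           net_inflow G (r2link X k s p) i = 0 \<and> net_inflow G (z2link X k s p) i = 0) \<and>
        (\<forall>i \<in> vcloud G.
           r2link X k s p i (nbr i) = r2path X k s p * xvirt X i s k \<and>
           r2link X k s p (nbr i) i = r2path X k s p * xvirt X i (s + 1) k \<and>
           z2link X k s p i (nbr i) = xvirt X i s k \<and>
           z2link X k s p (nbr i) i = xvirt X i (s + 1) k)) \<and>
     (\<forall>k \<in> flows G. \<forall>p \<in> {1..P}.
        net_inflow G (r2link X k 0 p) (Phys (src G k)) = - r2path X k 0 p \<and>
        net_inflow G (z2link X k 0 p) (Phys (src G k)) = - 1 \<and>
        (\<forall>i \<in> vnodes G - (vcloud G \<union> {Phys (src G k)}).
           net_inflow G (r2link X k 0 p) i = 0 \<and> net_inflow G (z2link X k 0 p) i = 0) \<and>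
        (\<forall>i \<in> vcloud G.
           net_inflow G (r2link X k 0 p) i = r2path X k 0 p * xvirt X i 1 k \<and>
           net_inflow G (z2link X k 0 p) i = xvirt X i 1 k)) \<and>
     (\<forall>k \<in> flows G. \<forall>p \<in> {1..P}. let l = sfc_len G k in
        (\<forall>i \<in> vcloud G.
           net_inflow G (r2link X k l p) i = - r2path X k l p * xvirt X i l k \<and>
           net_inflow G (z2link X k l p) i = - xvirt X i l k) \<and>
        (\<forall>i \<in> vnodes G - (vcloud G \<union> {Phys (dst G k)}).
           net_inflow G (r2link X k l p) i = 0 \<and> net_inflow G (z2link X k l p) i = 0) \<and>
        net_inflow G (r2link X k l p) (Phys (dst G k)) = r2path X k l p \<and>
        net_inflow G (z2link X k l p) (Phys (dst G k)) = 1)"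

end

(* Every function of a flow is hosted by exactly one virtual cloud node, and consecutive hosts are
   distinct because a virtual node processes at most one function of each flow. Hence for each stage
   exactly one pair (a, b) of (NS-I) is active, and the variables of (NS-II) are those of (NS-I) at
   the active pair; all other pairs carry zero flow. The two sets of conservation constraints agree
   because at most one of the two links at a virtual node can be used, so the balance at that node
   determines the values on both links. *)
theory Submission
  imports Defs
begin

section \<open>Sums of binary values, and sums and balances on the virtual network\<close>

text \<open>A sum of zeros and ones counts the ones, so the set where \<open>f\<close> is 1 has
  cardinality 1.\<close>

lemma sum_binary_eq_1_imp_ex1:
  fixes f :: "'a \<Rightarrow> real"
  assumes "finite A" and "\<And>w. w \<in> A \<Longrightarrow> f w \<in> {0, 1}" and "sum f A = 1"
  shows "\<exists>!w. w \<in> A \<and> f w = 1"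
proof -
  have "sum f A = (\<Sum>w \<in> A. of_bool (f w = 1))"
    using assms(2) by (intro sum.cong) auto
  also have "\<dots> = real (card {w \<in> A. f w = 1})"
    using assms(1) by (simp add: sum.If_cases of_bool_def Collect_conj_eq Int_commute)
  finally have "card {w \<in> A. f w = 1} = 1"
    using assms(3) by simp
  then obtain w where "{w \<in> A. f w = 1} = {w}"
    by (auto simp: card_1_singleton_iff)
  then show ?thesis by (auto simp: set_eq_iff)
qed

lemma finite_cloud: "valid_instance G \<Longrightarrow> finite (cloud G)"
  using finite_subset by (auto simp: valid_instance_def)

lemma finite_links: "valid_instance G \<Longrightarrow> finite (links G)"
  by (auto simp: valid_instance_def intro: finite_subset)

lemma vcloud_eq_image:
  "vcloud G = (\<lambda>(v, t). Virt v t) ` (SIGMA v:cloud G. {1..num_virt G v})"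
  by (auto simp: vcloud_def)

lemma finite_vcloud: "valid_instance G \<Longrightarrow> finite (vcloud G)"
  by (simp add: vcloud_eq_image finite_cloud)

text \<open>\<open>Virt\<close> is injective, so this is a reindexing. It links the constraint
  defining \<open>xzero\<close>, which sums over the copies of one cloud node, to sums over all
  virtual nodes.\<close>

lemma sum_vcloud:
  assumes "valid_instance G"
  shows "sum h (vcloud G) = (\<Sum>v \<in> cloud G. \<Sum>t = 1..num_virt G v. h (Virt v t))"
proof -
  have "inj_on (\<lambda>(v, t). Virt v t) (SIGMA v:cloud G. {1..num_virt G v})"
    by (auto simp: inj_on_def)
  then show ?thesis
    using finite_cloud[OF assms]
    by (simp add: vcloud_eq_image sum.reindex sum.Sigma o_def case_prod_unfold)
qed

text \<open>The only links at a virtual node join it to its neighbour, so both sums in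
  \<open>net_inflow\<close> have a single term.\<close>

lemma net_inflow_vcloud:
  assumes "w \<in> vcloud G"
  shows "net_inflow G g w = g (nbr w) w - g w (nbr w)"
proof -
  have "{j. (j, w) \<in> vlinks G} = {nbr w}" "{j. (w, j) \<in> vlinks G} = {nbr w}"
    using assms by (auto simp: vcloud_def vlinks_def)
  then show ?thesis by (simp add: net_inflow_def)
qed

lemma net_inflow_zero: "net_inflow G (\<lambda>_ _. 0) i = 0"
  by (simp add: net_inflow_def)

lemma vcloud_links: "w \<in> vcloud G \<Longrightarrow> (w, nbr w) \<in> vlinks G \<and> (nbr w, w) \<in> vlinks G"
  by (auto simp: vcloud_def vlinks_def)

text \<open>The added links have delay 0. This reconciles the latency constraints: (NS-II) sums over
  virtual links, (NS-I) over physical ones.\<close>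

lemma sum_vlinks_vdelay:
  assumes "valid_instance G"
  shows "(\<Sum>(i, j) \<in> vlinks G. vdelay G i j * z i j) =
         (\<Sum>(i, j) \<in> links G. delay G i j * z (Phys i) (Phys j))"
proof -
  let ?L = "(\<lambda>(i, j). (Phys i, Phys j)) ` links G"
  have "vlinks G \<subseteq> ?L \<union> (\<lambda>w. (nbr w, w)) ` vcloud G \<union> (\<lambda>w. (w, nbr w)) ` vcloud G"
    by (force simp: vlinks_def vcloud_def)
  then have fin: "finite (vlinks G)"
    using finite_links[OF assms] finite_vcloud[OF assms] by (meson finite_Un finite_imageI finite_subset)
  have "(\<Sum>(i, j) \<in> vlinks G. vdelay G i j * z i j) = (\<Sum>(i, j) \<in> ?L. vdelay G i j * z i j)"
    using fin by (intro sum.mono_neutral_right) (auto simp: vlinks_def)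
  also have "\<dots> = (\<Sum>(i, j) \<in> links G. delay G i j * z (Phys i) (Phys j))"
    by (subst sum.reindex) (auto simp: inj_on_def case_prod_unfold intro!: sum.cong)
  finally show ?thesis .
qed


subsection \<open>Hosts of the service functions\<close>

text \<open>With the source at index 0 and the destination at index \<open>sfc_len G k + 1\<close>,
  every stage \<open>s\<close> in \<open>{0..sfc_len G k}\<close> runs from host \<open>s\<close> to
  host \<open>Suc s\<close>. For the indices in between, \<open>THE\<close> is justified by
  \<open>ex1_host\<close>. The record scheme type makes the notion available for the points of both
  formulations.\<close>

definition host ::
  "('v, 'f, 'k) slicing_instance \<Rightarrow> ('v, 'k, 'e) common_point_scheme \<Rightarrow> 'k \<Rightarrow> nat \<Rightarrow> 'v vnode" where
  "host G X k s =
     (if s = 0 then Phys (src G k) else if s = sfc_len G k + 1 then Phys (dst G k)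
      else (THE w. w \<in> vcloud G \<and> xvirt X w s k = 1))"

lemma xvirt_binary:
  assumes "common_constraints G X" "k \<in> flows G" "w \<in> vcloud G" "s \<in> {1..sfc_len G k}"
  shows "xvirt X w s k \<in> {0, 1}"
proof -
  have "\<forall>w \<in> vcloud G. \<forall>k \<in> flows G. \<forall>s \<in> {1..sfc_len G k}. xvirt X w s k \<in> {0, 1}"
    using assms(1) unfolding common_constraints_def by (rule conjunct1)
  then show ?thesis using assms(2-4) by simp
qed

lemma sum_xvirt_le_1:
  assumes "common_constraints G X" "k \<in> flows G" "w \<in> vcloud G"
  shows "(\<Sum>s = 1..sfc_len G k. xvirt X w s k) \<le> 1"
  using assms unfolding common_constraints_def by blast

lemma sum_xzero:
  assumes "common_constraints G X" "k \<in> flows G" "s \<in> {1..sfc_len G k}"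
  shows "(\<Sum>v \<in> cloud G. xzero X v s k) = 1"
  using assms unfolding common_constraints_def by blast

lemma xzero_eq:
  assumes "common_constraints G X" "k \<in> flows G" "v \<in> cloud G" "s \<in> {1..sfc_len G k}"
  shows "xzero X v s k = (\<Sum>t = 1..num_virt G v. xvirt X (Virt v t) s k)"
  using assms unfolding common_constraints_def by blast

text \<open>Summing the links between \<open>xzero\<close> and \<open>xvirt\<close> over all cloud
  nodes gives total 1 for the binary values \<open>xvirt X w s k\<close>, so exactly one of them is
  1.\<close>

lemma ex1_host:
  assumes "valid_instance G" "common_constraints G X" "k \<in> flows G" "s \<in> {1..sfc_len G k}"
  shows "\<exists>!w. w \<in> vcloud G \<and> xvirt X w s k = 1"
proof (rule sum_binary_eq_1_imp_ex1)
  show "finite (vcloud G)" using assms(1) by (rule finite_vcloud)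
  show "xvirt X w s k \<in> {0, 1}" if "w \<in> vcloud G" for w
    using xvirt_binary[OF assms(2,3) that assms(4)] .
  have "(\<Sum>w \<in> vcloud G. xvirt X w s k) = (\<Sum>v \<in> cloud G. xzero X v s k)"
    unfolding sum_vcloud[OF assms(1)]
    using xzero_eq[OF assms(2,3) _ assms(4)] by (intro sum.cong) (auto simp del: atLeastAtMost_iff)
  then show "(\<Sum>w \<in> vcloud G. xvirt X w s k) = 1"
    using sum_xzero[OF assms(2-4)] by simp
qed

text \<open>Reading \<open>xvirt\<close> as the indicator of the host turns the right-hand sides of
  the conservation constraints into balances of a path between two hosts.\<close>

lemma
  assumes "valid_instance G" "common_constraints G X" "k \<in> flows G" "s \<in> {1..sfc_len G k}"
  shows host_in_vcloud: "host G X k s \<in> vcloud G"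
    and xvirt_eq_host: "w \<in> vcloud G \<Longrightarrow> xvirt X w s k = of_bool (w = host G X k s)"
proof -
  note ex1 = ex1_host[OF assms]
  have h: "host G X k s = (THE w. w \<in> vcloud G \<and> xvirt X w s k = 1)"
    using assms(4) by (simp add: host_def)
  show "host G X k s \<in> vcloud G"
    using theI'[OF ex1] unfolding h by blast
  assume w: "w \<in> vcloud G"
  then have "xvirt X w s k \<in> {0, 1}"
    using xvirt_binary[OF assms(2,3) _ assms(4)] by simp
  then show "xvirt X w s k = of_bool (w = host G X k s)"
    using theI'[OF ex1] ex1 w unfolding h by auto
qed

lemma host_0 [simp]: "host G X k 0 = Phys (src G k)"
  by (simp add: host_def)

lemma host_last [simp]: "host G X k (Suc (sfc_len G k)) = Phys (dst G k)"
  by (simp add: host_def)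

lemma Phys_notin_vcloud [simp]: "Phys v \<notin> vcloud G"
  by (simp add: vcloud_def)

text \<open>At the first and last stage one host is physical and the other virtual, because the
  chain is nonempty. At any other stage a common host would have two values \<open>xvirt\<close>
  equal to 1, against the bound 1 on their sum over the functions of the flow.\<close>

lemma host_neq_host_Suc:
  assumes "valid_instance G" "common_constraints G X" "k \<in> flows G" "s \<in> {0..sfc_len G k}"
  shows "host G X k s \<noteq> host G X k (Suc s)"
proof -
  have len: "1 \<le> sfc_len G k" using assms by (auto simp: valid_instance_def)
  consider "s = 0" | "s = sfc_len G k" | "s \<ge> 1" "s < sfc_len G k"
    using assms(4) by fastforce
  then show ?thesis
  proof cases
    case 1
    then show ?thesis
      using host_in_vcloud[OF assms(1-3), of 1] len 1 by (auto simp: vcloud_def)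
  next
    case 2
    then show ?thesis
      using host_in_vcloud[OF assms(1-3), of s] len 2 by (auto simp: vcloud_def)
  next
    case 3
    let ?w = "host G X k s"
    have w: "?w \<in> vcloud G" using host_in_vcloud[OF assms(1-3)] 3 by simp
    show ?thesis
    proof
      assume eq: "?w = host G X k (Suc s)"
      have "xvirt X ?w s k = 1" "xvirt X ?w (Suc s) k = 1"
        using xvirt_eq_host[OF assms(1-3)] w 3 eq by auto
      then have "2 = (\<Sum>i \<in> {s, Suc s}. xvirt X ?w i k)"
        by simp
      also have "\<dots> \<le> (\<Sum>i = 1..sfc_len G k. xvirt X ?w i k)"
        using 3 w xvirt_eq_host[OF assms(1-3)] by (intro sum_mono2) auto
      also have "\<dots> \<le> 1"
        using sum_xvirt_le_1[OF assms(2,3) w] .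
      finally show False by simp
    qed
  qed
qed

lemma host_pair_in_pairs:
  assumes "valid_instance G" "common_constraints G X" "k \<in> flows G" "s \<in> {0..sfc_len G k}"
  shows "(host G X k s, host G X k (Suc s)) \<in> pairs G k s"
proof -
  have "host G X k s \<in> vcloud G" if "s \<noteq> 0"
    using host_in_vcloud[OF assms(1-3)] assms(4) that by simp
  moreover have "host G X k (Suc s) \<in> vcloud G" if "s \<noteq> sfc_len G k"
    using host_in_vcloud[OF assms(1-3)] assms(4) that by simp
  ultimately show ?thesis by (auto simp: pairs_def)
qed

text \<open>Extends the indicator form to the two fictitious indices, where \<open>xext\<close> and
  \<open>host\<close> follow the same convention; membership in \<open>vcloud G\<close> is therefore
  asked only for genuine functions.\<close>

lemma xext_eq_host:
  assumes "valid_instance G" "common_constraints G X" "k \<in> flows G" "s \<le> sfc_len G k + 1"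
    and "1 \<le> s \<Longrightarrow> s \<le> sfc_len G k \<Longrightarrow> w \<in> vcloud G"
  shows "xext G X w s k = of_bool (w = host G X k s)"
proof (cases "s \<in> {1..sfc_len G k}")
  case True
  then show ?thesis
    using xvirt_eq_host[OF assms(1-3) True] assms(5) by (simp add: xext_def)
next
  case False
  then have "s = 0 \<or> s = sfc_len G k + 1" using assms(4) by auto
  then show ?thesis by (auto simp: xext_def)
qed

text \<open>The product of the indicators of the two hosts is the indicator of the pair of
  hosts.\<close>

lemma pair_active_eq:
  assumes "valid_instance G" "common_constraints G X" "k \<in> flows G" "s \<in> {0..sfc_len G k}"
    and "(a, b) \<in> pairs G k s"
  shows "pair_active G X k s a b = of_bool ((a, b) = (host G X k s, host G X k (Suc s)))"
proof -
  have "xext G X a s k = of_bool (a = host G X k s)"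
    using assms(4,5) by (intro xext_eq_host[OF assms(1-3)]) (auto simp: pairs_def)
  moreover have "xext G X b (s + 1) k = of_bool (b = host G X k (s + 1))"
    using assms(4,5) by (intro xext_eq_host[OF assms(1-3)]) (auto simp: pairs_def)
  ultimately show ?thesis by (simp add: pair_active_def)
qed

lemma finite_pairs: "valid_instance G \<Longrightarrow> finite (pairs G k s)"
  by (simp add: pairs_def finite_vcloud)


subsection \<open>Routing one path between a fixed pair of nodes\<close>

text \<open>Collects the constraints on one path that mention neither of its endpoints; (NS-II)
  imposes them in the same form at every stage.\<close>

definition admissible_path ::
  "('v, 'f, 'k) slicing_instance \<Rightarrow> real \<Rightarrow> real \<Rightarrow>
     ('v vnode \<Rightarrow> 'v vnode \<Rightarrow> real) \<Rightarrow> ('v vnode \<Rightarrow> 'v vnode \<Rightarrow> real) \<Rightarrow> bool" where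
  "admissible_path G lam r f z \<longleftrightarrow>
     r \<ge> 0 \<and>
     (\<forall>(i, j) \<in> vlinks G. f i j \<ge> 0 \<and> z i j \<in> {0, 1} \<and> f i j \<le> lam * z i j) \<and>
     (\<forall>w \<in> vcloud G. z w (nbr w) + z (nbr w) w \<le> 1)"

text \<open>The common ground of the two formulations. For \<open>a \<noteq> b\<close> the
  difference of indicators merges the three cases of the conservation constraints of (NS-I); for
  \<open>a = b\<close> it is 0, whereas (NS-I) then imposes two cases at once.\<close>

definition routes ::
  "('v, 'f, 'k) slicing_instance \<Rightarrow> real \<Rightarrow> 'v vnode \<Rightarrow> 'v vnode \<Rightarrow> real \<Rightarrow>
     ('v vnode \<Rightarrow> 'v vnode \<Rightarrow> real) \<Rightarrow> ('v vnode \<Rightarrow> 'v vnode \<Rightarrow> real) \<Rightarrow> bool" where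
  "routes G lam a b r f z \<longleftrightarrow>
     admissible_path G lam r f z \<and>
     (\<forall>i \<in> vnodes G.
        net_inflow G f i = r * (of_bool (i = b) - of_bool (i = a)) \<and>
        net_inflow G z i = of_bool (i = b) - of_bool (i = a))"

text \<open>At most one of the two binary \<open>z\<close> values is 1, so their difference
  determines both. Where \<open>z\<close> is 0, the bound by \<open>lam * z\<close> forces
  \<open>f\<close> to 0, and the balance of \<open>f\<close> then fixes its value on the other
  link.\<close>

lemma vcloud_balance_iff:
  assumes "admissible_path G lam r f z" "w \<in> vcloud G" "a \<noteq> b"
  shows "net_inflow G f w = r * (of_bool (w = b) - of_bool (w = a)) \<and>
         net_inflow G z w = of_bool (w = b) - of_bool (w = a) \<longleftrightarrow>
         f w (nbr w) = r * of_bool (w = a) \<and> f (nbr w) w = r * of_bool (w = b) \<and>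
         z w (nbr w) = of_bool (w = a) \<and> z (nbr w) w = of_bool (w = b)"
proof -
  have "f w (nbr w) \<ge> 0" "z w (nbr w) \<in> {0, 1}" "f w (nbr w) \<le> lam * z w (nbr w)"
    "f (nbr w) w \<ge> 0" "z (nbr w) w \<in> {0, 1}" "f (nbr w) w \<le> lam * z (nbr w) w"
    "z w (nbr w) + z (nbr w) w \<le> 1"
    using assms(1,2) vcloud_links[OF assms(2)] by (auto simp: admissible_path_def)
  then show ?thesis
    using assms(2,3) by (auto simp: net_inflow_vcloud)
qed

text \<open>Applies the local equivalence at every virtual node. The result has the shape of the
  intermediate stages of (NS-II): balances at physical nodes, explicit link values at virtual
  ones.\<close>

lemma routes_vcloud_iff:
  assumes "a \<noteq> b"
  shows "routes G lam a b r f z \<longleftrightarrow>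
     admissible_path G lam r f z \<and>
     (\<forall>i \<in> vnodes G - vcloud G.
        net_inflow G f i = r * (of_bool (i = b) - of_bool (i = a)) \<and>
        net_inflow G z i = of_bool (i = b) - of_bool (i = a)) \<and>
     (\<forall>w \<in> vcloud G.
        f w (nbr w) = r * of_bool (w = a) \<and> f (nbr w) w = r * of_bool (w = b) \<and>
        z w (nbr w) = of_bool (w = a) \<and> z (nbr w) w = of_bool (w = b))"
    (is "_ \<longleftrightarrow> _ \<and> ?N \<and> ?V")
proof (cases "admissible_path G lam r f z")
  case True
  have "vcloud G \<subseteq> vnodes G" by (simp add: vnodes_def)
  moreover have "?V \<longleftrightarrow> (\<forall>w \<in> vcloud G.
        net_inflow G f w = r * (of_bool (w = b) - of_bool (w = a)) \<and>
        net_inflow G z w = of_bool (w = b) - of_bool (w = a))"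
    using vcloud_balance_iff[OF True _ assms] by (intro ball_cong) auto
  ultimately show ?thesis
    using True unfolding routes_def by blast
qed (simp add: routes_def)

text \<open>The partition of the nodes by which (NS-II) states its first and last stage, with
  \<open>v\<close> the source or the destination.\<close>

lemma ball_vnodes_iff:
  assumes "v \<in> nodes G"
  shows "(\<forall>i \<in> vnodes G. Q i) \<longleftrightarrow>
    Q (Phys v) \<and> (\<forall>i \<in> vnodes G - (vcloud G \<union> {Phys v}). Q i) \<and> (\<forall>i \<in> vcloud G. Q i)"
  using assms by (auto simp: vnodes_def)

text \<open>A physical start is not in \<open>vcloud G\<close> and a virtual end is not physical, so
  at each node at most one indicator survives. This is the shape of stage 0 of (NS-II).\<close>

lemma routes_from_Phys_iff:
  assumes "b \<in> vcloud G" "v \<in> nodes G"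
  shows "routes G lam (Phys v) b r f z \<longleftrightarrow>
     admissible_path G lam r f z \<and>
     net_inflow G f (Phys v) = - r \<and> net_inflow G z (Phys v) = - 1 \<and>
     (\<forall>i \<in> vnodes G - (vcloud G \<union> {Phys v}). net_inflow G f i = 0 \<and> net_inflow G z i = 0) \<and>
     (\<forall>i \<in> vcloud G. net_inflow G f i = r * of_bool (i = b) \<and> net_inflow G z i = of_bool (i = b))"
proof -
  let ?Q = "\<lambda>i. net_inflow G f i = r * (of_bool (i = b) - of_bool (i = Phys v)) \<and>
        net_inflow G z i = of_bool (i = b) - of_bool (i = Phys v)"
  have "?Q (Phys v) \<longleftrightarrow> net_inflow G f (Phys v) = - r \<and> net_inflow G z (Phys v) = - 1"
    using assms(1) by (cases "b = Phys v") auto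
  moreover have "(\<forall>i \<in> vnodes G - (vcloud G \<union> {Phys v}). ?Q i) \<longleftrightarrow>
     (\<forall>i \<in> vnodes G - (vcloud G \<union> {Phys v}). net_inflow G f i = 0 \<and> net_inflow G z i = 0)"
    using assms(1) by (intro ball_cong) auto
  moreover have "(\<forall>i \<in> vcloud G. ?Q i) \<longleftrightarrow>
     (\<forall>i \<in> vcloud G. net_inflow G f i = r * of_bool (i = b) \<and> net_inflow G z i = of_bool (i = b))"
    by (intro ball_cong) auto
  ultimately show ?thesis
    unfolding routes_def ball_vnodes_iff[OF assms(2)] by (simp only: conj_assoc)
qed

text \<open>The mirror image, in the shape of the last stage of (NS-II).\<close>

lemma routes_to_Phys_iff:
  assumes "a \<in> vcloud G" "v \<in> nodes G"
  shows "routes G lam a (Phys v) r f z \<longleftrightarrow>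
     admissible_path G lam r f z \<and>
     net_inflow G f (Phys v) = r \<and> net_inflow G z (Phys v) = 1 \<and>
     (\<forall>i \<in> vnodes G - (vcloud G \<union> {Phys v}). net_inflow G f i = 0 \<and> net_inflow G z i = 0) \<and>
     (\<forall>i \<in> vcloud G. net_inflow G f i = - r * of_bool (i = a) \<and> net_inflow G z i = - of_bool (i = a))"
proof -
  let ?Q = "\<lambda>i. net_inflow G f i = r * (of_bool (i = Phys v) - of_bool (i = a)) \<and>
        net_inflow G z i = of_bool (i = Phys v) - of_bool (i = a)"
  have "?Q (Phys v) \<longleftrightarrow> net_inflow G f (Phys v) = r \<and> net_inflow G z (Phys v) = 1"
    using assms(1) by (cases "a = Phys v") auto
  moreover have "(\<forall>i \<in> vnodes G - (vcloud G \<union> {Phys v}). ?Q i) \<longleftrightarrow>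
     (\<forall>i \<in> vnodes G - (vcloud G \<union> {Phys v}). net_inflow G f i = 0 \<and> net_inflow G z i = 0)"
    using assms(1) by (intro ball_cong) auto
  moreover have "(\<forall>i \<in> vcloud G. ?Q i) \<longleftrightarrow>
     (\<forall>i \<in> vcloud G. net_inflow G f i = - r * of_bool (i = a) \<and> net_inflow G z i = - of_bool (i = a))"
    by (intro ball_cong) auto
  ultimately show ?thesis
    unfolding routes_def ball_vnodes_iff[OF assms(2)] by (simp only: conj_assoc)
qed


subsection \<open>The two formulations in terms of hosts\<close>

text \<open>Merges the three conservation blocks of (NS-II) into one predicate indexed by the stage.
  Since chains are nonempty, the tests for the first and last stage never both succeed.\<close>

definition ns2_conservation ::
  "('v, 'f, 'k) slicing_instance \<Rightarrow> ('v, 'k) ns2_point \<Rightarrow> 'k \<Rightarrow> nat \<Rightarrow> nat \<Rightarrow> bool" where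
  "ns2_conservation G X k s p \<longleftrightarrow>
     (if s = 0 then
        net_inflow G (r2link X k 0 p) (Phys (src G k)) = - r2path X k 0 p \<and>
        net_inflow G (z2link X k 0 p) (Phys (src G k)) = - 1 \<and>
        (\<forall>i \<in> vnodes G - (vcloud G \<union> {Phys (src G k)}).
           net_inflow G (r2link X k 0 p) i = 0 \<and> net_inflow G (z2link X k 0 p) i = 0) \<and>
        (\<forall>i \<in> vcloud G.
           net_inflow G (r2link X k 0 p) i = r2path X k 0 p * xvirt X i 1 k \<and>
           net_inflow G (z2link X k 0 p) i = xvirt X i 1 k)
      else if s = sfc_len G k then
        (\<forall>i \<in> vcloud G.
           net_inflow G (r2link X k s p) i = - r2path X k s p * xvirt X i s k \<and>
           net_inflow G (z2link X k s p) i = - xvirt X i s k) \<and>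
        (\<forall>i \<in> vnodes G - (vcloud G \<union> {Phys (dst G k)}).
           net_inflow G (r2link X k s p) i = 0 \<and> net_inflow G (z2link X k s p) i = 0) \<and>
        net_inflow G (r2link X k s p) (Phys (dst G k)) = r2path X k s p \<and>
        net_inflow G (z2link X k s p) (Phys (dst G k)) = 1
      else
        (\<forall>i \<in> vnodes G - vcloud G.
           net_inflow G (r2link X k s p) i = 0 \<and> net_inflow G (z2link X k s p) i = 0) \<and>
        (\<forall>i \<in> vcloud G.
           r2link X k s p i (nbr i) = r2path X k s p * xvirt X i s k \<and>
           r2link X k s p (nbr i) i = r2path X k s p * xvirt X i (s + 1) k \<and>
           z2link X k s p i (nbr i) = xvirt X i s k \<and>
           z2link X k s p (nbr i) i = xvirt X i (s + 1) k))"

text \<open>Once \<open>xvirt\<close> is replaced by host indicators, each branch is one of the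
  three characterisations of \<open>routes\<close>. Admissibility stays on the left because the
  intermediate case relies on it to pass between link values and balances.\<close>

lemma ns2_conservation_iff_routes:
  assumes "valid_instance G" "common_constraints G X" "k \<in> flows G" "s \<in> {0..sfc_len G k}"
  shows "admissible_path G lam (r2path X k s p) (r2link X k s p) (z2link X k s p) \<and>
           ns2_conservation G X k s p \<longleftrightarrow>
         routes G lam (host G X k s) (host G X k (Suc s))
           (r2path X k s p) (r2link X k s p) (z2link X k s p)"
proof -
  note vc = host_in_vcloud[OF assms(1-3)] and xvirt = xvirt_eq_host[OF assms(1-3)]
  have len: "1 \<le> sfc_len G k" and nodes: "src G k \<in> nodes G" "dst G k \<in> nodes G"
    using assms by (auto simp: valid_instance_def)
  consider "s = 0" | "s = sfc_len G k" "s \<noteq> 0" | "s \<ge> 1" "s < sfc_len G k"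
    using assms(4) by fastforce
  then show ?thesis
  proof cases
    case 1
    have one: "1 \<in> {1..sfc_len G k}" using len by simp
    have "ns2_conservation G X k s p \<longleftrightarrow>
        net_inflow G (r2link X k s p) (Phys (src G k)) = - r2path X k s p \<and>
        net_inflow G (z2link X k s p) (Phys (src G k)) = - 1 \<and>
        (\<forall>i \<in> vnodes G - (vcloud G \<union> {Phys (src G k)}).
           net_inflow G (r2link X k s p) i = 0 \<and> net_inflow G (z2link X k s p) i = 0) \<and>
        (\<forall>i \<in> vcloud G.
           net_inflow G (r2link X k s p) i = r2path X k s p * xvirt X i 1 k \<and>
           net_inflow G (z2link X k s p) i = xvirt X i 1 k)"
      by (simp only: 1 ns2_conservation_def if_True simp_thms)
    moreover have "host G X k s = Phys (src G k)" "host G X k (Suc s) = host G X k 1"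
      using 1 by simp_all
    ultimately show ?thesis
      by (simp only: routes_from_Phys_iff[OF vc[OF one] nodes(1)] xvirt[OF one]
          cong: ball_cong)
  next
    case 2
    then have stage: "s \<in> {1..sfc_len G k}" by simp
    have "ns2_conservation G X k s p \<longleftrightarrow>
        net_inflow G (r2link X k s p) (Phys (dst G k)) = r2path X k s p \<and>
        net_inflow G (z2link X k s p) (Phys (dst G k)) = 1 \<and>
        (\<forall>i \<in> vnodes G - (vcloud G \<union> {Phys (dst G k)}).
           net_inflow G (r2link X k s p) i = 0 \<and> net_inflow G (z2link X k s p) i = 0) \<and>
        (\<forall>i \<in> vcloud G.
           net_inflow G (r2link X k s p) i = - r2path X k s p * xvirt X i s k \<and>
           net_inflow G (z2link X k s p) i = - xvirt X i s k)"
      unfolding ns2_conservation_def if_not_P[OF 2(2)] if_P[OF 2(1)] by (simp only: conj_ac)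
    moreover have "host G X k (Suc s) = Phys (dst G k)"
      using 2(1) host_last by metis
    ultimately show ?thesis
      by (simp only: routes_to_Phys_iff[OF vc[OF stage] nodes(2)] xvirt[OF stage]
          cong: ball_cong)
  next
    case 3
    have "s \<noteq> 0" "s \<noteq> sfc_len G k" using 3 by auto
    then have cons: "ns2_conservation G X k s p \<longleftrightarrow>
        (\<forall>i \<in> vnodes G - vcloud G.
           net_inflow G (r2link X k s p) i = 0 \<and> net_inflow G (z2link X k s p) i = 0) \<and>
        (\<forall>i \<in> vcloud G.
           r2link X k s p i (nbr i) = r2path X k s p * xvirt X i s k \<and>
           r2link X k s p (nbr i) i = r2path X k s p * xvirt X i (s + 1) k \<and>
           z2link X k s p i (nbr i) = xvirt X i s k \<and>
           z2link X k s p (nbr i) i = xvirt X i (s + 1) k)"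
      by (simp only: ns2_conservation_def if_False)
    \<comment> \<open>Both hosts of an intermediate stage are virtual, so both indicators vanish
      outside \<open>vcloud G\<close>.\<close>
    have "(\<forall>i \<in> vnodes G - vcloud G.
          net_inflow G f i = r * (of_bool (i = host G X k (Suc s)) - of_bool (i = host G X k s)) \<and>
          net_inflow G z i = of_bool (i = host G X k (Suc s)) - of_bool (i = host G X k s)) \<longleftrightarrow>
        (\<forall>i \<in> vnodes G - vcloud G. net_inflow G f i = 0 \<and> net_inflow G z i = 0)" for r f z
      using vc[of s] vc[of "Suc s"] 3 by (intro ball_cong) auto
    moreover have "s \<in> {1..sfc_len G k}" "s + 1 \<in> {1..sfc_len G k}" using 3 by auto
    ultimately show ?thesis
      unfolding routes_vcloud_iff[OF host_neq_host_Suc[OF assms]] cons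
      by (simp only: xvirt Suc_eq_plus1 cong: ball_cong)
  qed
qed

text \<open>A regrouping of the constraints by stage, with latency moved to physical links.
  Admissibility and conservation are bracketed together so that they can be replaced by
  \<open>routes\<close> as a unit.\<close>

lemma ns2_feasible_iff_conservation:
  assumes "valid_instance G"
  shows "ns2_feasible G P X \<longleftrightarrow>
     common_constraints G X \<and>
     (\<forall>k \<in> flows G. \<forall>s \<in> {0..sfc_len G k}. (\<Sum>p = 1..P. r2path X k s p) = data_rate G k s) \<and>
     (\<forall>k \<in> flows G. \<forall>s \<in> {0..sfc_len G k}. \<forall>p \<in> {1..P}.
        (admissible_path G (data_rate G k s) (r2path X k s p) (r2link X k s p) (z2link X k s p) \<and>
         ns2_conservation G X k s p) \<and>
        theta X k s \<ge> (\<Sum>(i, j) \<in> links G. delay G i j * z2link X k s p (Phys i) (Phys j))) \<and>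
     (\<forall>(i, j) \<in> links G.
        (\<Sum>k \<in> flows G. \<Sum>s = 0..sfc_len G k. \<Sum>p = 1..P. r2link X k s p (Phys i) (Phys j))
          \<le> capacity G i j)"
proof -
  have len: "1 \<le> sfc_len G k" if "k \<in> flows G" for k
    using assms that by (auto simp: valid_instance_def)
  have split: "(\<forall>s \<in> {0..sfc_len G k}. Q s) \<longleftrightarrow>
      (\<forall>s \<in> {1..sfc_len G k} - {sfc_len G k}. Q s) \<and> Q 0 \<and> Q (sfc_len G k)" for Q k
  proof -
    have "{0..sfc_len G k} = {1..sfc_len G k} - {sfc_len G k} \<union> {0, sfc_len G k}" by auto
    then show ?thesis by blast
  qed
  have conservation: "(\<forall>k \<in> flows G. \<forall>s \<in> {0..sfc_len G k}. \<forall>p \<in> {1..P}. ns2_conservation G X k s p) \<longleftrightarrow>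
     (\<forall>k \<in> flows G. \<forall>s \<in> {1..sfc_len G k} - {sfc_len G k}. \<forall>p \<in> {1..P}.
        (\<forall>i \<in> vnodes G - vcloud G.
           net_inflow G (r2link X k s p) i = 0 \<and> net_inflow G (z2link X k s p) i = 0) \<and>
        (\<forall>i \<in> vcloud G.
           r2link X k s p i (nbr i) = r2path X k s p * xvirt X i s k \<and>
           r2link X k s p (nbr i) i = r2path X k s p * xvirt X i (s + 1) k \<and>
           z2link X k s p i (nbr i) = xvirt X i s k \<and>
           z2link X k s p (nbr i) i = xvirt X i (s + 1) k)) \<and>
     (\<forall>k \<in> flows G. \<forall>p \<in> {1..P}.
        net_inflow G (r2link X k 0 p) (Phys (src G k)) = - r2path X k 0 p \<and>
        net_inflow G (z2link X k 0 p) (Phys (src G k)) = - 1 \<and>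
        (\<forall>i \<in> vnodes G - (vcloud G \<union> {Phys (src G k)}).
           net_inflow G (r2link X k 0 p) i = 0 \<and> net_inflow G (z2link X k 0 p) i = 0) \<and>
        (\<forall>i \<in> vcloud G.
           net_inflow G (r2link X k 0 p) i = r2path X k 0 p * xvirt X i 1 k \<and>
           net_inflow G (z2link X k 0 p) i = xvirt X i 1 k)) \<and>
     (\<forall>k \<in> flows G. \<forall>p \<in> {1..P}. let l = sfc_len G k in
        (\<forall>i \<in> vcloud G.
           net_inflow G (r2link X k l p) i = - r2path X k l p * xvirt X i l k \<and>
           net_inflow G (z2link X k l p) i = - xvirt X i l k) \<and>
        (\<forall>i \<in> vnodes G - (vcloud G \<union> {Phys (dst G k)}).
           net_inflow G (r2link X k l p) i = 0 \<and> net_inflow G (z2link X k l p) i = 0) \<and>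
        net_inflow G (r2link X k l p) (Phys (dst G k)) = r2path X k l p \<and>
        net_inflow G (z2link X k l p) (Phys (dst G k)) = 1)"
    (is "?C \<longleftrightarrow> ?M \<and> ?S \<and> (\<forall>k \<in> flows G. \<forall>p \<in> {1..P}. ?D' k p)")
  proof -
    have "?M \<longleftrightarrow> (\<forall>k \<in> flows G. \<forall>s \<in> {1..sfc_len G k} - {sfc_len G k}. \<forall>p \<in> {1..P}.
        ns2_conservation G X k s p)"
      by (intro ball_cong refl) (simp add: ns2_conservation_def)
    moreover have "?S \<longleftrightarrow> (\<forall>k \<in> flows G. \<forall>p \<in> {1..P}. ns2_conservation G X k 0 p)"
      by (intro ball_cong refl) (simp add: ns2_conservation_def)
    moreover have "(\<forall>k \<in> flows G. \<forall>p \<in> {1..P}. ?D' k p) \<longleftrightarrow> (\<forall>k \<in> flows G. \<forall>p \<in> {1..P}. ns2_conservation G X k (sfc_len G k) p)"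
    proof (intro ball_cong refl)
      fix k p assume "k \<in> flows G"
      \<comment> \<open>Keeps the last stage out of the branch for \<open>s = 0\<close> in
        \<open>ns2_conservation\<close>.\<close>
      then have "sfc_len G k \<noteq> 0" using len by fastforce
      then show "?D' k p \<longleftrightarrow> ns2_conservation G X k (sfc_len G k) p"
        unfolding ns2_conservation_def Let_def by (simp only: if_False if_True simp_thms)
    qed
    ultimately show ?thesis by (simp only: split ball_conj_distrib)
  qed
  show ?thesis
    unfolding ns2_feasible_def sum_vlinks_vdelay[OF assms] admissible_path_def conservation[symmetric]
    by (simp only: ball_conj_distrib conj_ac)
qed

lemma ns2_feasible_iff:
  assumes "valid_instance G"
  shows "ns2_feasible G P X \<longleftrightarrow>
     common_constraints G X \<and>
     (\<forall>k \<in> flows G. \<forall>s \<in> {0..sfc_len G k}. (\<Sum>p = 1..P. r2path X k s p) = data_rate G k s) \<and>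
     (\<forall>k \<in> flows G. \<forall>s \<in> {0..sfc_len G k}. \<forall>p \<in> {1..P}.
        routes G (data_rate G k s) (host G X k s) (host G X k (Suc s))
          (r2path X k s p) (r2link X k s p) (z2link X k s p) \<and>
        theta X k s \<ge> (\<Sum>(i, j) \<in> links G. delay G i j * z2link X k s p (Phys i) (Phys j))) \<and>
     (\<forall>(i, j) \<in> links G.
        (\<Sum>k \<in> flows G. \<Sum>s = 0..sfc_len G k. \<Sum>p = 1..P. r2link X k s p (Phys i) (Phys j))
          \<le> capacity G i j)"
  unfolding ns2_feasible_iff_conservation[OF assms]
  using ns2_conservation_iff_routes[OF assms]
  by (intro conj_cong ball_cong refl) auto

section \<open>The constraints of (NS-I) for one pair and one path\<close>

text \<open>The activity of the pair is a parameter \<open>\<pi>\<close>, so that active and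
  inactive pairs are treated by setting it to 1 or 0. The body follows the constraints of (NS-I)
  literally, which makes \<open>ns1_feasible_iff\<close> a mere unfolding.\<close>

definition ns1_path ::
  "('v, 'f, 'k) slicing_instance \<Rightarrow> real \<Rightarrow> real \<Rightarrow> 'v vnode \<Rightarrow> 'v vnode \<Rightarrow> real \<Rightarrow>
     ('v vnode \<Rightarrow> 'v vnode \<Rightarrow> real) \<Rightarrow> ('v vnode \<Rightarrow> 'v vnode \<Rightarrow> real) \<Rightarrow> bool" where
  "ns1_path G lam \<pi> a b r f z \<longleftrightarrow>
     r \<ge> 0 \<and>
     (\<forall>(i, j) \<in> vlinks G. f i j \<ge> 0 \<and> z i j \<in> {0, 1} \<and> z i j \<le> \<pi> \<and> f i j \<le> lam * z i j) \<and>
     (\<forall>w \<in> vcloud G.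
        (w \<in> {a, b} \<longrightarrow> z w (nbr w) + z (nbr w) w \<le> 1) \<and>
        (w \<notin> {a, b} \<longrightarrow> z w (nbr w) + z (nbr w) w = 0)) \<and>
     (\<forall>i \<in> vnodes G.
        (i = a \<longrightarrow> net_inflow G f i = - r) \<and>
        (i \<noteq> a \<and> i \<noteq> b \<longrightarrow> net_inflow G f i = 0) \<and>
        (i = b \<longrightarrow> net_inflow G f i = r) \<and>
        (i = a \<longrightarrow> net_inflow G z i = - \<pi>) \<and>
        (i \<noteq> a \<and> i \<noteq> b \<longrightarrow> net_inflow G z i = 0) \<and>
        (i = b \<longrightarrow> net_inflow G z i = \<pi>))"

text \<open>Serves the inactive pairs, including those with \<open>a = b\<close>, where the two
  balance cases agree because both demand 0.\<close>

lemma ns1_path_zero: "ns1_path G lam 0 a b 0 (\<lambda>_ _. 0) (\<lambda>_ _. 0)"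
  by (simp add: ns1_path_def net_inflow_zero)

text \<open>The bound \<open>z \<le> 1\<close> is automatic for binary values. The one condition of
  (NS-I) that \<open>routes\<close> does not state, no use of links at other virtual nodes, follows
  from the explicit link values in \<open>routes_vcloud_iff\<close>.\<close>

lemma ns1_path_iff_routes:
  assumes "a \<noteq> b"
  shows "ns1_path G lam 1 a b r f z \<longleftrightarrow> routes G lam a b r f z"
proof
  assume ns1: "ns1_path G lam 1 a b r f z"
  then have "admissible_path G lam r f z"
    by (force simp: ns1_path_def admissible_path_def)
  then show "routes G lam a b r f z"
    using ns1 assms by (auto simp: routes_def ns1_path_def)
next
  assume routes: "routes G lam a b r f z"
  then have "\<forall>w \<in> vcloud G. z w (nbr w) = of_bool (w = a) \<and> z (nbr w) w = of_bool (w = b)"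
    using routes_vcloud_iff[OF assms] by blast
  then show "ns1_path G lam 1 a b r f z"
    using routes assms by (fastforce simp: routes_def ns1_path_def admissible_path_def)
qed

lemma ns1_feasible_iff:
  "ns1_feasible G P X \<longleftrightarrow>
     common_constraints G X \<and>
     (\<forall>k \<in> flows G. \<forall>s \<in> {0..sfc_len G k}. \<forall>(a, b) \<in> pairs G k s.
        (\<Sum>p = 1..P. r1path X k s a b p) = data_rate G k s * pair_active G X k s a b) \<and>
     (\<forall>k \<in> flows G. \<forall>s \<in> {0..sfc_len G k}. \<forall>(a, b) \<in> pairs G k s. \<forall>p \<in> {1..P}.
        ns1_path G (data_rate G k s) (pair_active G X k s a b) a b
          (r1path X k s a b p) (r1link X k s a b p) (z1link X k s a b p)) \<and>
     (\<forall>(i, j) \<in> links G.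
        (\<Sum>k \<in> flows G. \<Sum>s = 0..sfc_len G k. \<Sum>(a, b) \<in> pairs G k s. \<Sum>p = 1..P.
           r1link X k s a b p (Phys i) (Phys j)) \<le> capacity G i j) \<and>
     (\<forall>k \<in> flows G. \<forall>s \<in> {0..sfc_len G k}. \<forall>p \<in> {1..P}.
        theta X k s \<ge> (\<Sum>(a, b) \<in> pairs G k s. \<Sum>(i, j) \<in> links G.
           delay G i j * z1link X k s a b p (Phys i) (Phys j)))"
  unfolding ns1_feasible_def ns1_path_def ..

section \<open>Transfer of feasible points between the formulations\<close>

text \<open>The flow of each stage is copied to the pair of hosts and set to 0 on all other pairs,
  so the capacity and latency sums keep their values.\<close>

lemma ns2_imp_ns1:
  fixes X :: "('v, 'k) ns2_point"
  assumes "valid_instance G" "ns2_feasible G P X"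
  shows "\<exists>X1. ns1_feasible G P X1 \<and> objective G \<sigma> X1 = objective G \<sigma> X"
proof -
  \<comment> \<open>\<open>act\<close> uses the hosts of \<open>X\<close>; as \<open>X1\<close>
    copies \<open>xvirt\<close>, it also marks the active pairs of \<open>X1\<close>.\<close>
  define act where "act k s a b \<longleftrightarrow> (a, b) = (host G X k s, host G X k (Suc s))" for k s a b
  define X1 :: "('v, 'k) ns1_point" where
    "X1 = \<lparr>xvirt = xvirt X, xzero = xzero X, yact = yact X,
       theta = theta X, thetaL = thetaL X, thetaN = thetaN X,
       r1path = (\<lambda>k s a b p. if act k s a b then r2path X k s p else 0),
       r1link = (\<lambda>k s a b p. if act k s a b then r2link X k s p else (\<lambda>_ _. 0)),
       z1link = (\<lambda>k s a b p. if act k s a b then z2link X k s p else (\<lambda>_ _. 0))\<rparr>"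
  note X2 = assms(2)[unfolded ns2_feasible_iff[OF assms(1)]]
  then have cc: "common_constraints G X" by blast
  have rate: "(\<Sum>p = 1..P. r2path X k s p) = data_rate G k s"
    if "k \<in> flows G" "s \<in> {0..sfc_len G k}" for k s
    using X2 that by blast
  have routes: "routes G (data_rate G k s) (host G X k s) (host G X k (Suc s))
        (r2path X k s p) (r2link X k s p) (z2link X k s p)"
    and latency: "theta X k s \<ge> (\<Sum>(i, j) \<in> links G. delay G i j * z2link X k s p (Phys i) (Phys j))"
    if "k \<in> flows G" "s \<in> {0..sfc_len G k}" "p \<in> {1..P}" for k s p
    using X2 that by blast+
  have cap: "(\<Sum>k \<in> flows G. \<Sum>s = 0..sfc_len G k. \<Sum>p = 1..P. r2link X k s p (Phys i) (Phys j))
      \<le> capacity G i j" if "(i, j) \<in> links G" for i j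
    using X2 that by blast
  note hosts = host_pair_in_pairs[OF assms(1) cc]
  have cc1: "common_constraints G X1"
    using cc unfolding common_constraints_def X1_def common_point.select_convs .
  have \<pi>: "pair_active G X1 k s a b = of_bool (act k s a b)"
    if "k \<in> flows G" "s \<in> {0..sfc_len G k}" "(a, b) \<in> pairs G k s" for k s a b
  proof -
    have "pair_active G X1 k s a b = pair_active G X k s a b"
      unfolding pair_active_def xext_def X1_def common_point.select_convs ..
    then show ?thesis
      unfolding act_def using pair_active_eq[OF assms(1) cc that] by (rule trans)
  qed
  \<comment> \<open>Sums over pairs reduce to the term of the hosts; used for both capacity and
    latency.\<close>
  have collapse: "(\<Sum>(a, b) \<in> pairs G k s. g a b) = g (host G X k s) (host G X k (Suc s))"
    if "k \<in> flows G" "s \<in> {0..sfc_len G k}" "\<And>a b. \<not> act k s a b \<Longrightarrow> g a b = 0"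
    for k s and g :: "'v vnode \<Rightarrow> 'v vnode \<Rightarrow> real"
  proof -
    have "(\<Sum>(a, b) \<in> pairs G k s. g a b) = (\<Sum>(a, b) \<in> {(host G X k s, host G X k (Suc s))}. g a b)"
      using hosts[OF that(1,2)] finite_pairs[OF assms(1)] that(3)
      by (intro sum.mono_neutral_right) (auto simp: act_def)
    then show ?thesis by simp
  qed
  have act_host: "act k s (host G X k s) (host G X k (Suc s))" for k s
    by (simp add: act_def)
  have "ns1_feasible G P X1"
    unfolding ns1_feasible_iff
  proof (intro conjI ballI cc1; clarify?)
    fix k s a b assume ks: "k \<in> flows G" "s \<in> {0..sfc_len G k}" "(a, b) \<in> pairs G k s"
    show "(\<Sum>p = 1..P. r1path X1 k s a b p) = data_rate G k s * pair_active G X1 k s a b"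
      using rate[OF ks(1,2)] \<pi>[OF ks] by (simp add: X1_def)
    fix p assume p: "p \<in> {1..P}"
    show "ns1_path G (data_rate G k s) (pair_active G X1 k s a b) a b
          (r1path X1 k s a b p) (r1link X1 k s a b p) (z1link X1 k s a b p)"
    proof (cases "act k s a b")
      case True
      then show ?thesis
        using routes[OF ks(1,2) p] host_neq_host_Suc[OF assms(1) cc ks(1,2)] \<pi>[OF ks]
        by (simp add: X1_def act_def ns1_path_iff_routes)
    next
      case False
      then show ?thesis
        using \<pi>[OF ks] by (simp add: X1_def ns1_path_zero)
    qed
  next
    fix i j assume "(i, j) \<in> links G"
    have "(\<Sum>(a, b) \<in> pairs G k s. \<Sum>p = 1..P. r1link X1 k s a b p (Phys i) (Phys j)) =
        (\<Sum>p = 1..P. r2link X k s p (Phys i) (Phys j))"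
      if "k \<in> flows G" "s \<in> {0..sfc_len G k}" for k s
      by (subst collapse[OF that]) (simp_all add: X1_def act_host)
    then show "(\<Sum>k \<in> flows G. \<Sum>s = 0..sfc_len G k. \<Sum>(a, b) \<in> pairs G k s. \<Sum>p = 1..P.
        r1link X1 k s a b p (Phys i) (Phys j)) \<le> capacity G i j"
      using cap[OF \<open>(i, j) \<in> links G\<close>] by (simp only: cong: sum.cong)
  next
    fix k s p assume ks: "k \<in> flows G" "s \<in> {0..sfc_len G k}" and p: "p \<in> {1..P}"
    have "(\<Sum>(a, b) \<in> pairs G k s. \<Sum>(i, j) \<in> links G.
        delay G i j * z1link X1 k s a b p (Phys i) (Phys j)) =
        (\<Sum>(i, j) \<in> links G. delay G i j * z2link X k s p (Phys i) (Phys j))"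
      by (subst collapse[OF ks]) (simp_all add: X1_def act_host)
    then show "(\<Sum>(a, b) \<in> pairs G k s. \<Sum>(i, j) \<in> links G.
        delay G i j * z1link X1 k s a b p (Phys i) (Phys j)) \<le> theta X1 k s"
      using latency[OF ks p] by (simp add: X1_def)
  qed
  moreover have "objective G \<sigma> X1 = objective G \<sigma> X"
    by (simp add: objective_def X1_def)
  ultimately show ?thesis by blast
qed

text \<open>The values at the pair of hosts are kept and the others dropped. All dropped terms are
  nonnegative, so the capacity and latency sums can only decrease.\<close>

lemma ns1_imp_ns2:
  fixes X :: "('v, 'k) ns1_point"
  assumes "valid_instance G" "ns1_feasible G P X"
  shows "\<exists>X2. ns2_feasible G P X2 \<and> objective G \<sigma> X2 = objective G \<sigma> X"
proof -
  define X2 :: "('v, 'k) ns2_point" where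
    "X2 = \<lparr>xvirt = xvirt X, xzero = xzero X, yact = yact X,
       theta = theta X, thetaL = thetaL X, thetaN = thetaN X,
       r2path = (\<lambda>k s. r1path X k s (host G X k s) (host G X k (Suc s))),
       r2link = (\<lambda>k s. r1link X k s (host G X k s) (host G X k (Suc s))),
       z2link = (\<lambda>k s. z1link X k s (host G X k s) (host G X k (Suc s)))\<rparr>"
  note X1 = assms(2)[unfolded ns1_feasible_iff]
  then have cc: "common_constraints G X" by blast
  note hosts = host_pair_in_pairs[OF assms(1) cc]
  have cc2: "common_constraints G X2"
    using cc unfolding common_constraints_def X2_def common_point.select_convs .
  \<comment> \<open>\<open>host\<close> depends on the point only through \<open>xvirt\<close>,
    which is copied.\<close>
  have host2: "host G X2 = host G X"
    by (intro ext) (simp add: host_def X2_def)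
  have \<pi>: "pair_active G X k s (host G X k s) (host G X k (Suc s)) = 1"
    if "k \<in> flows G" "s \<in> {0..sfc_len G k}" for k s
    using pair_active_eq[OF assms(1) cc that hosts[OF that]] by simp
  have path: "ns1_path G (data_rate G k s) (pair_active G X k s a b) a b
      (r1path X k s a b p) (r1link X k s a b p) (z1link X k s a b p)"
    if "k \<in> flows G" "s \<in> {0..sfc_len G k}" "(a, b) \<in> pairs G k s" "p \<in> {1..P}" for k s a b p
    using X1 that by blast
  have pos: "0 \<le> r1link X k s a b p (Phys i) (Phys j)" "0 \<le> z1link X k s a b p (Phys i) (Phys j)"
    if "k \<in> flows G" "s \<in> {0..sfc_len G k}" "(a, b) \<in> pairs G k s" "p \<in> {1..P}" "(i, j) \<in> links G"
    for k s a b p i j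
  proof -
    have "(Phys i, Phys j) \<in> vlinks G" using that by (simp add: vlinks_def)
    then show "0 \<le> r1link X k s a b p (Phys i) (Phys j)"
        "0 \<le> z1link X k s a b p (Phys i) (Phys j)"
      using path[OF that(1-4)] by (force simp: ns1_path_def)+
  qed
  have le_sum: "h (host G X k s) (host G X k (Suc s)) \<le> (\<Sum>(a, b) \<in> pairs G k s. h a b)"
    if "k \<in> flows G" "s \<in> {0..sfc_len G k}" "\<And>a b. (a, b) \<in> pairs G k s \<Longrightarrow> 0 \<le> h a b"
    for k s and h :: "'v vnode \<Rightarrow> 'v vnode \<Rightarrow> real"
    using member_le_sum[OF hosts[OF that(1,2)], of "case_prod h"] that finite_pairs[OF assms(1)]
    by auto
  have "ns2_feasible G P X2"
    unfolding ns2_feasible_iff[OF assms(1)] host2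
  proof (intro conjI ballI cc2; clarify?)
    fix k s assume ks: "k \<in> flows G" "s \<in> {0..sfc_len G k}"
    show "(\<Sum>p = 1..P. r2path X2 k s p) = data_rate G k s"
      using X1 ks hosts[OF ks] \<pi>[OF ks] by (fastforce simp: X2_def)
    fix p assume p: "p \<in> {1..P}"
    show "routes G (data_rate G k s) (host G X k s) (host G X k (Suc s))
        (r2path X2 k s p) (r2link X2 k s p) (z2link X2 k s p)"
      using path[OF ks hosts[OF ks] p] host_neq_host_Suc[OF assms(1) cc ks] \<pi>[OF ks]
      by (simp add: X2_def ns1_path_iff_routes)
    \<comment> \<open>Nonnegative delays make every term of the sum over pairs nonnegative, as
      \<open>le_sum\<close> requires.\<close>
    have "(\<Sum>(i, j) \<in> links G. delay G i j * z2link X2 k s p (Phys i) (Phys j)) \<le>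
        (\<Sum>(a, b) \<in> pairs G k s. \<Sum>(i, j) \<in> links G.
           delay G i j * z1link X k s a b p (Phys i) (Phys j))"
      unfolding X2_def ns2_point.simps
    proof (rule le_sum[OF ks])
      fix a b assume "(a, b) \<in> pairs G k s"
      then show "0 \<le> (\<Sum>(i, j) \<in> links G. delay G i j * z1link X k s a b p (Phys i) (Phys j))"
        using assms(1) pos(2)[OF ks _ p]
        by (intro sum_nonneg) (auto simp: valid_instance_def intro!: mult_nonneg_nonneg)
    qed
    also have "\<dots> \<le> theta X2 k s"
      using X1 ks p by (simp add: X2_def)
    finally show "(\<Sum>(i, j) \<in> links G. delay G i j * z2link X2 k s p (Phys i) (Phys j)) \<le> theta X2 k s" .
  next
    fix i j assume ij: "(i, j) \<in> links G"
    have "(\<Sum>k \<in> flows G. \<Sum>s = 0..sfc_len G k. \<Sum>p = 1..P. r2link X2 k s p (Phys i) (Phys j)) \<le>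
        (\<Sum>k \<in> flows G. \<Sum>s = 0..sfc_len G k. \<Sum>(a, b) \<in> pairs G k s. \<Sum>p = 1..P.
           r1link X k s a b p (Phys i) (Phys j))"
      unfolding X2_def ns2_point.simps
      by (intro sum_mono le_sum sum_nonneg pos(1)[OF _ _ _ _ ij])
    also have "\<dots> \<le> capacity G i j"
      using X1 ij by blast
    finally show "(\<Sum>k \<in> flows G. \<Sum>s = 0..sfc_len G k. \<Sum>p = 1..P.
        r2link X2 k s p (Phys i) (Phys j)) \<le> capacity G i j" .
  qed
  moreover have "objective G \<sigma> X2 = objective G \<sigma> X"
    by (simp add: objective_def X2_def)
  ultimately show ?thesis by blast
qed

theorem theorem1:
  fixes G :: "('v, 'f, 'k) slicing_instance" and P :: nat and \<sigma> :: real
  assumes "valid_instance G" and "P \<ge> 1" and "\<sigma> \<ge> 0"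
  shows "(\<forall>X2. ns2_feasible G P X2 \<longrightarrow>
            (\<exists>X1. ns1_feasible G P X1 \<and> objective G \<sigma> X1 = objective G \<sigma> X2)) \<and>
         (\<forall>X1. ns1_feasible G P X1 \<longrightarrow>
            (\<exists>X2. ns2_feasible G P X2 \<and> objective G \<sigma> X2 = objective G \<sigma> X1))"
  using assms(1) ns2_imp_ns1 ns1_imp_ns2 by blast

end
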